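(* Suppose that the following hold. (i) The convex objective function $f$ is strictly convex on $X$. (ii) There is $L_h>0$ such that $\|h(x)-h(y)\|\le L_h\|x-y\|$ for all $x,y\in X$. (iii) There is a constant $\sigma>0$ such that for each $k$, $\mathbb{E}(\epsilon^k\mid\mathcal{F}^{k-1})=0$ and $\mathbb{E}(\|\epsilon^k\|^2\mid\mathcal{F}^{k-1})\le\sigma^2$, where $\mathcal{F}^{k-1}$ is the $\sigma$-algebra generated by $\{\epsilon^1,\dots,\epsilon^{k-1}\}$. Let $c^k=c^0k^{-q}$ (for $k\ge1$) with $c^0>0$ and $q\in(\tfrac12,1]$. If the dual problem $\max_{y\in\mathbb{R}^M}g(y)$ has a unique solution $y^*$, then the iterates $y^k$ of the stochastic augmented Lagrangian method described in the context converge almost surely to $y^*$.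
   Context: Problem: minimize $f(x)=f_0(x)+f_1(x)$, $f_1(x):=\mathbb{E}_\xi(F(x,\xi))$, over $x\in X$ subject to $h(x):=(h_1(x),\dots,h_M(x))^T\le 0$. Here $X\subseteq\mathbb{R}^n$ is nonempty, convex and compact; $\xi$ is a random variable with distribution $P$ supported on $\Omega$ (independent of $x$); $f_0,h_1,\dots,h_M:\mathbb{R}^n\to\mathbb{R}$ are continuously differentiable and convex; $F:\mathbb{R}^n\times\Omega\to\mathbb{R}$ is continuously differentiable and convex in $x$ for almost every $\xi\in\Omega$. Notation: $\mathbb{R}^M_+=\{z\in\mathbb{R}^M: z\ge 0\}$; $(\cdot)_+$ is the metric projection onto the nonnegative orthant; $\max\{0,\cdot\}$ is componentwise; $\|\cdot\|$ is the Euclidean norm. Augmented Lagrangian (for $y\in\mathbb{R}^M_+$, $c>0$): $L(x,y,c):=f(x)+\frac c2\big\|\big(h(x)+\frac yc\big)_+\big\|^2-\frac1{2c}\|y\|^2$. Dual essential objective function: $g(y):=\inf_{x\in X}\{f(x)+\langle h(x),y\rangle\}$ if $y\in\mathbb{R}^M_+$, and $g(y):=-\infty$ otherwise. Stochastic augmented Lagrangian method (SALM): given $(x^0,y^0)\in\mathbb{R}^n\times\mathbb{R}^M_+$, numbers $c^k>0$ and random errors $\epsilon^{k+1}\in\mathbb{R}^n$, for $k=0,1,2,\dots$ $$\hat x^{k+1}=\arg\min_{x\in X}L(x,y^k,c^k),\qquad x^{k+1}=\hat x^{k+1}-c^k\epsilon^{k+1},\qquad y^{k+1}=\max\{0,\;y^k+c^kh(x^{k+1})\}.$$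 *)

theory Defs
  imports "HOL-Analysis.Analysis" "HOL-Probability.Probability"
begin

definition cont_differentiable :: "(real^'n \<Rightarrow> real) \<Rightarrow> bool" where
  "cont_differentiable f \<longleftrightarrow>
     (\<exists>G. (\<forall>x. GDERIV f x :> G x) \<and> continuous_on UNIV G)"

definition strictly_convex_on :: "(real^'n) set \<Rightarrow> (real^'n \<Rightarrow> real) \<Rightarrow> bool" where
  "strictly_convex_on X f \<longleftrightarrow> convex X \<and>
     (\<forall>x\<in>X. \<forall>y\<in>X. \<forall>t. x \<noteq> y \<and> 0 < t \<and> t < 1 \<longrightarrow>
        f ((1 - t) *\<^sub>R x + t *\<^sub>R y) < (1 - t) * f x + t * f y)"

definition nonneg_orthant :: "(real^'m) set" where
  "nonneg_orthant = {z. \<forall>i. 0 \<le> z $ i}"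

definition pos_proj :: "real^'m \<Rightarrow> real^'m" where
  "pos_proj z = closest_point nonneg_orthant z"

definition max0 :: "real^'m \<Rightarrow> real^'m" where
  "max0 z = (\<chi> i. max 0 (z $ i))"

text \<open>The measure \<open>P\<close> is the distribution of the random variable \<open>\<xi>\<close>, with
  \<open>space P\<close> as the set \<open>\<Omega>\<close>; the expectation over \<open>\<xi>\<close> is the integral over \<open>P\<close>.\<close>

definition objective ::
  "(real^'n \<Rightarrow> real) \<Rightarrow> 's measure \<Rightarrow> (real^'n \<Rightarrow> 's \<Rightarrow> real) \<Rightarrow> real^'n \<Rightarrow> real" where
  "objective f0 P F x = f0 x + (\<integral>\<xi>. F x \<xi> \<partial>P)"

definition aug_lagrangian ::
  "(real^'n \<Rightarrow> real) \<Rightarrow> (real^'n \<Rightarrow> real^'m) \<Rightarrow> real^'n \<Rightarrow> real^'m \<Rightarrow> real \<Rightarrow> real" where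
  "aug_lagrangian f h x y c =
     f x + c / 2 * (norm (pos_proj (h x + y /\<^sub>R c)))\<^sup>2 - 1 / (2 * c) * (norm y)\<^sup>2"

definition dual_fun ::
  "(real^'n) set \<Rightarrow> (real^'n \<Rightarrow> real) \<Rightarrow> (real^'n \<Rightarrow> real^'m) \<Rightarrow> real^'m \<Rightarrow> ereal" where
  "dual_fun X f h y =
     (if y \<in> nonneg_orthant then INF x\<in>X. ereal (f x + h x \<bullet> y) else -\<infinity>)"

definition dual_solutions ::
  "(real^'n) set \<Rightarrow> (real^'n \<Rightarrow> real) \<Rightarrow> (real^'n \<Rightarrow> real^'m) \<Rightarrow> (real^'m) set" where
  "dual_solutions X f h = {y. is_arg_max (dual_fun X f h) (\<lambda>_. True) y}"

text \<open>A realisation of the stochastic augmented Lagrangian method, given the penalty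
  parameters \<open>c k\<close> and one realisation \<open>e 1, e 2, \<dots>\<close> of the errors. Here \<open>xh\<close> is the
  sequence of exact minimisers; \<open>xh 0\<close> and \<open>e 0\<close> play no role.\<close>

definition SALM ::
  "(real^'n) set \<Rightarrow> (real^'n \<Rightarrow> real) \<Rightarrow> (real^'n \<Rightarrow> real^'m) \<Rightarrow> real^'n \<Rightarrow> real^'m \<Rightarrow>
   (nat \<Rightarrow> real) \<Rightarrow> (nat \<Rightarrow> real^'n) \<Rightarrow>
   (nat \<Rightarrow> real^'n) \<Rightarrow> (nat \<Rightarrow> real^'n) \<Rightarrow> (nat \<Rightarrow> real^'m) \<Rightarrow> bool" where
  "SALM X f h x0 y0 c e xh x y \<longleftrightarrow>
     x 0 = x0 \<and> y 0 = y0 \<and>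
     (\<forall>k. is_arg_min (\<lambda>z. aug_lagrangian f h z (y k) (c k)) (\<lambda>z. z \<in> X) (xh (Suc k)) \<and>
          x (Suc k) = xh (Suc k) - c k *\<^sub>R e (Suc k) \<and>
          y (Suc k) = max0 (y k + c k *\<^sub>R h (x (Suc k))))"

definition error_sigma_algebra ::
  "'w measure \<Rightarrow> (nat \<Rightarrow> 'w \<Rightarrow> real^'n) \<Rightarrow> nat \<Rightarrow> 'w measure" where
  "error_sigma_algebra M \<epsilon> k =
     sigma (space M) (\<Union>j\<in>{1..k}. {\<epsilon> j -` A \<inter> space M | A. A \<in> sets borel})"

text \<open>The conditional second moment is taken with the \<open>ennreal\<close>-valued \<open>nn_cond_exp\<close>, which is
  meaningful without prior integrability. On a probability space, its bound makes
  every \<open>\<epsilon> k\<close> (\<open>k \<ge> 1\<close>) square integrable, hence integrable, so that \<open>real_cond_exp\<close> of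
  the coordinates is the genuine conditional expectation.\<close>

definition error_condition ::
  "'w measure \<Rightarrow> (nat \<Rightarrow> 'w \<Rightarrow> real^'n) \<Rightarrow> real \<Rightarrow> bool" where
  "error_condition M \<epsilon> \<sigma> \<longleftrightarrow>
     (\<forall>k\<ge>1. (\<forall>i. AE \<omega> in M.
                real_cond_exp M (error_sigma_algebra M \<epsilon> (k - 1)) (\<lambda>\<omega>. \<epsilon> k \<omega> $ i) \<omega> = 0) \<and>
             (AE \<omega> in M.
                nn_cond_exp M (error_sigma_algebra M \<epsilon> (k - 1))
                  (\<lambda>\<omega>. ennreal ((norm (\<epsilon> k \<omega>))\<^sup>2)) \<omega> \<le> ennreal (\<sigma>\<^sup>2)))"

end

theory Submission
  imports Defs
begin

text \<open>
  The augmented Lagrangian method is the proximal point method for the concave dual problem: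
  if \<open>xh\<close> minimises \<open>aug_lagrangian f h \<sqdot> y c\<close> over \<open>X\<close>, then
  \<open>u = max0 (y + c h(xh))\<close> maximises \<open>g - \<parallel>\<sqdot> - y\<parallel>\<^sup>2 / (2 c)\<close>.  What the proof uses is the
  inequality
  \<open>\<parallel>u - p\<parallel>\<^sup>2 \<le> \<parallel>y - p\<parallel>\<^sup>2 - 2 c (g p - g u)\<close> for every \<open>p \<ge> 0\<close>
  (lemma \<open>augmented_lagrangian_step_is_proximal\<close>).

  The stochastic method takes this step with an error, and the key observation is that the
  errors are almost surely \<^emph>\<open>absolutely summable\<close>, so that the convergence proof is pathwise.
  The noise enters \<open>x\<^sup>k\<^sup>+\<^sup>1\<close> with the factor \<open>c\<^sup>k\<close>, and \<open>h(x\<^sup>k\<^sup>+\<^sup>1)\<close> enters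
  \<open>y\<^sup>k\<^sup>+\<^sup>1\<close> with a second factor \<open>c\<^sup>k\<close>; the dual error is thus of order
  \<open>(c\<^sup>k)\<^sup>2 \<parallel>\<epsilon>\<^sup>k\<^sup>+\<^sup>1\<parallel>\<close>.  As the second moments of the noise are bounded and
  \<open>\<Sum> (c\<^sup>k)\<^sup>2 < \<infinity>\<close>, the series \<open>\<Sum> (c\<^sup>k)\<^sup>2 \<parallel>\<epsilon>\<^sup>k\<^sup>+\<^sup>1\<parallel>\<^sup>2\<close> converges almost surely
  (lemma \<open>weighted_squared_errors_summable\<close>).  This gives the summability of the dual errors, and
  it also forces \<open>c\<^sup>k \<epsilon>\<^sup>k\<^sup>+\<^sup>1 \<longlonglongrightarrow> 0\<close>, so that the points \<open>x\<^sup>k\<close>, which may lie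
  outside \<open>X\<close>, stay in a bounded set on which the \<open>C\<^sup>1\<close> map \<open>h\<close> is Lipschitz.

  A proximal point method with summable errors and \<open>\<Sum> c\<^sup>k = \<infinity>\<close> converges to the unique
  maximiser \<open>p\<close> (lemma \<open>inexact_proximal_point_converges\<close>): the distances to \<open>p\<close> converge because
  they decrease up to summable terms, and a positive limit would keep the gaps \<open>g p - g y\<^sup>k\<close>
  bounded away from zero by compactness, against the summability of \<open>c\<^sup>k (g p - g y\<^sup>k)\<close>.
\<close>

section \<open>The positive part of a vector\<close>

lemma nonneg_orthant_convex_closed:
  "convex (nonneg_orthant :: (real^'m) set)" "closed (nonneg_orthant :: (real^'m) set)"
  "(nonneg_orthant :: (real^'m) set) \<noteq> {}"
proof -
  show "convex (nonneg_orthant :: (real^'m) set)"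
    by (auto simp: convex_def nonneg_orthant_def)
  have "(nonneg_orthant :: (real^'m) set) = (\<Inter>i. {z. 0 \<le> z $ i})"
    by (auto simp: nonneg_orthant_def)
  moreover have "closed {z :: real^'m. 0 \<le> z $ i}" for i
    by (intro closed_Collect_le continuous_intros)
  ultimately show "closed (nonneg_orthant :: (real^'m) set)"
    by (metis (no_types, lifting) closed_INT)
  show "(nonneg_orthant :: (real^'m) set) \<noteq> {}"
    by (auto simp: nonneg_orthant_def intro!: exI[of _ 0])
qed

lemma max0_mem_nonneg_orthant: "max0 z \<in> nonneg_orthant"
  by (simp add: max0_def nonneg_orthant_def)

lemma pos_proj_eq_max0: "pos_proj z = max0 z"
proof -
  have "norm (z - max0 z) \<le> norm (z - u)" if "u \<in> nonneg_orthant" for u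
  proof (rule norm_le_componentwise_cart)
    show "norm ((z - max0 z) $ i) \<le> norm ((z - u) $ i)" for i
      using that by (auto simp: max0_def nonneg_orthant_def max_def dest!: spec[of _ i])
  qed
  then show ?thesis
    unfolding pos_proj_def
    using closest_point_unique[OF nonneg_orthant_convex_closed(1,2) max0_mem_nonneg_orthant, of z]
    by (metis dist_norm)
qed

lemma max0_obtuse:
  assumes "u \<in> nonneg_orthant"
  shows "(z - max0 z) \<bullet> (u - max0 z) \<le> 0"
  using closest_point_dot[OF nonneg_orthant_convex_closed(1,2) assms, of z]
  by (simp add: pos_proj_eq_max0 flip: pos_proj_def)

lemma max0_nonexpansive: "norm (max0 a - max0 b) \<le> norm (a - b)"
  using closest_point_lipschitz[OF nonneg_orthant_convex_closed, of a b]
  by (simp add: dist_norm pos_proj_eq_max0 flip: pos_proj_def)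

lemma norm_max0_mono:
  assumes "\<And>i. a $ i \<le> b $ i"
  shows "norm (max0 a) \<le> norm (max0 b)"
proof (rule norm_le_componentwise_cart)
  show "norm (max0 a $ i) \<le> norm (max0 b $ i)" for i
    using assms[of i] by (simp add: max0_def)
qed

text \<open>The function \<open>\<parallel>max0 \<sqdot>\<parallel>\<^sup>2 / 2\<close> has the gradient \<open>max0\<close>, which is 1-Lipschitz; this is the
  corresponding quadratic upper bound.\<close>

lemma norm_max0_add_sq_le:
  "(norm (max0 (a + d)))\<^sup>2 \<le> (norm (max0 a))\<^sup>2 + 2 * (max0 a \<bullet> d) + (norm d)\<^sup>2"
proof -
  have "(max 0 (s + t))\<^sup>2 \<le> (max 0 s)\<^sup>2 + 2 * (max 0 s * t) + t\<^sup>2" for s t :: real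
  proof (cases "s \<ge> 0")
    case True
    then show ?thesis
      by (auto simp: max_def power2_eq_square algebra_simps)
        (use zero_le_square[of "s + t"] in \<open>simp add: algebra_simps\<close>)
  next
    case False
    then have "(max 0 (s + t))\<^sup>2 \<le> t\<^sup>2"
      by (auto simp: max_def intro!: power_mono)
    then show ?thesis
      using False by simp
  qed
  then have "(\<Sum>i\<in>UNIV. (max 0 (a $ i + d $ i))\<^sup>2)
      \<le> (\<Sum>i\<in>UNIV. (max 0 (a $ i))\<^sup>2 + 2 * (max 0 (a $ i) * d $ i) + (d $ i)\<^sup>2)"
    by (intro sum_mono) auto
  also have "\<dots> = (norm (max0 a))\<^sup>2 + 2 * (max0 a \<bullet> d) + (norm d)\<^sup>2"
    by (simp only: power2_norm_eq_inner)
      (simp add: max0_def inner_vec_def sum.distrib sum_distrib_left power2_eq_square)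
  finally show ?thesis
    by (simp only: power2_norm_eq_inner) (simp add: max0_def inner_vec_def power2_eq_square)
qed

section \<open>The dual function and the exact multiplier step\<close>

text \<open>The real-valued version of \<open>dual_fun\<close>, used where the infimum is finite.  It is extended by
  the same formula beyond the nonnegative orthant, so that it is continuous everywhere.\<close>

definition real_dual ::
  "(real^'n) set \<Rightarrow> (real^'n \<Rightarrow> real) \<Rightarrow> (real^'n \<Rightarrow> real^'m) \<Rightarrow> real^'m \<Rightarrow> real" where
  "real_dual X f h y = (INF x\<in>X. f x + h x \<bullet> y)"

lemma lagrangian_bdd_below:
  assumes "bdd_below (f ` X)" "\<And>x. x \<in> X \<Longrightarrow> norm (h x) \<le> H"
  shows "bdd_below ((\<lambda>x. f x + h x \<bullet> y) ` X)"
proof -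
  obtain m where m: "\<And>x. x \<in> X \<Longrightarrow> m \<le> f x"
    using assms(1) by (auto simp: bdd_below_def)
  have "m - H * norm y \<le> f x + h x \<bullet> y" if "x \<in> X" for x
  proof -
    have "\<bar>h x \<bullet> y\<bar> \<le> H * norm y"
      using Cauchy_Schwarz_ineq2[of "h x" y] mult_right_mono[OF assms(2)[OF that], of "norm y"]
      by simp
    then show ?thesis
      using m[OF that] by linarith
  qed
  then show ?thesis
    by (auto simp: bdd_below_def)
qed

lemma dual_fun_eq_real_dual:
  assumes "X \<noteq> {}" "bdd_below ((\<lambda>x. f x + h x \<bullet> y) ` X)" "y \<in> nonneg_orthant"
  shows "dual_fun X f h y = ereal (real_dual X f h y)"
  using ereal_Inf'[OF assms(2)] assms(1,3)
  by (simp add: dual_fun_def real_dual_def image_image)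

text \<open>An infimum of affine functions with uniformly bounded slopes \<open>h x\<close> is Lipschitz.\<close>

lemma real_dual_continuous:
  assumes X: "X \<noteq> {}" and f: "bdd_below (f ` X)" and H: "\<And>x. x \<in> X \<Longrightarrow> norm (h x) \<le> H"
  shows "continuous_on S (real_dual X f h)"
proof -
  have le: "real_dual X f h u \<le> real_dual X f h v + H * norm (u - v)" for u v
  proof -
    have "real_dual X f h u - H * norm (u - v) \<le> f x + h x \<bullet> v" if "x \<in> X" for x
    proof -
      have "real_dual X f h u \<le> f x + h x \<bullet> u"
        unfolding real_dual_def using that by (intro cINF_lower lagrangian_bdd_below[OF f H])
      moreover have "h x \<bullet> (u - v) \<le> H * norm (u - v)"
        using Cauchy_Schwarz_ineq2[of "h x" "u - v"]
          mult_right_mono[OF H[OF that], of "norm (u - v)"] by simp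
      ultimately show ?thesis
        by (simp add: inner_diff_right)
    qed
    then have "real_dual X f h u - H * norm (u - v) \<le> real_dual X f h v"
      unfolding real_dual_def[of X f h v] by (intro cINF_greatest[OF X])
    then show ?thesis
      by simp
  qed
  have "0 \<le> H"
    using X H norm_ge_zero order_trans by blast
  moreover have "dist (real_dual X f h u) (real_dual X f h v) \<le> H * dist u v" for u v
    using le[of u v] le[of v u] by (simp add: dist_norm norm_minus_commute)
  ultimately have "H-lipschitz_on S (real_dual X f h)"
    by (intro lipschitz_onI)
  then show ?thesis
    by (rule lipschitz_on_continuous_on)
qed

text \<open>Compare the minimiser with the points \<open>xh + t (x - xh)\<close> and let \<open>t \<rightarrow> 0\<close>: to first order in
  \<open>t\<close> the quadratic penalty acts like the linear functional with the coefficient vector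
  \<open>max0 (y + c h(xh))\<close>, the gradient of the penalty term with respect to the value of \<open>h\<close>.\<close>

lemma aug_lagrangian_minimizer_minimizes_lagrangian:
  assumes f: "convex_on X f" and h: "\<And>i. convex_on X (\<lambda>x. h x $ i)" and c: "c > 0"
    and xh: "is_arg_min (\<lambda>z. aug_lagrangian f h z y c) (\<lambda>z. z \<in> X) xh" and x: "x \<in> X"
  defines "u \<equiv> max0 (y + c *\<^sub>R h xh)"
  shows "f xh + h xh \<bullet> u \<le> f x + h x \<bullet> u"
proof -
  define d where "d = h x - h xh"
  define a where "a = h xh + y /\<^sub>R c"
  define C where "C = c / 2 * (norm d)\<^sup>2"
  have xhX: "xh \<in> X"
    using xh by (simp add: is_arg_min_def)
  have u: "u = c *\<^sub>R max0 a"
    using c by (simp add: u_def a_def max0_def vec_eq_iff max_mult_distrib_left distrib_left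
        add.commute flip: mult.assoc)
  have first_order: "0 \<le> (f x - f xh + u \<bullet> d) + t * C" if t: "0 < t" "t < 1" for t
  proof -
    let ?xt = "(1 - t) *\<^sub>R xh + t *\<^sub>R x"
    have "convex X"
      using f by (rule convex_on_imp_convex)
    then have "?xt \<in> X"
      using t x xhX by (auto simp: convex_alt)
    then have min: "aug_lagrangian f h xh y c \<le> aug_lagrangian f h ?xt y c"
      using xh by (auto simp: is_arg_min_def not_less)
    have ft: "f ?xt \<le> f xh + t * (f x - f xh)"
      using convex_onD[OF f, of t xh x] t x xhX by (simp add: algebra_simps)
    have "h ?xt $ i \<le> (h xh + t *\<^sub>R d) $ i" for i
      using convex_onD[OF h, of t xh x i] t x xhX by (simp add: d_def algebra_simps)
    then have "norm (max0 (h ?xt + y /\<^sub>R c)) \<le> norm (max0 (a + t *\<^sub>R d))"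
      by (intro norm_max0_mono) (simp add: a_def algebra_simps)
    then have "(norm (max0 (h ?xt + y /\<^sub>R c)))\<^sup>2 \<le> (norm (max0 (a + t *\<^sub>R d)))\<^sup>2"
      by (intro power_mono) auto
    also have "\<dots> \<le> (norm (max0 a))\<^sup>2 + 2 * (max0 a \<bullet> (t *\<^sub>R d)) + (norm (t *\<^sub>R d))\<^sup>2"
      by (rule norm_max0_add_sq_le)
    finally have "c / 2 * (norm (max0 (h ?xt + y /\<^sub>R c)))\<^sup>2 \<le>
        c / 2 * ((norm (max0 a))\<^sup>2 + 2 * (max0 a \<bullet> (t *\<^sub>R d)) + (norm (t *\<^sub>R d))\<^sup>2)"
      using c by (intro mult_left_mono) auto
    also have "\<dots> = c / 2 * (norm (max0 a))\<^sup>2 + t * (u \<bullet> d) + t * (t * C)"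
      by (simp add: u C_def algebra_simps power2_eq_square)
    finally have "0 \<le> t * (f x - f xh) + t * (u \<bullet> d) + t * (t * C)"
      using min ft by (simp add: aug_lagrangian_def pos_proj_eq_max0 a_def)
    then have "0 \<le> t * ((f x - f xh + u \<bullet> d) + t * C)"
      by (simp add: algebra_simps)
    then show ?thesis
      using t by (simp add: zero_le_mult_iff)
  qed
  have "((\<lambda>t. (f x - f xh + u \<bullet> d) + t * C) \<longlongrightarrow> (f x - f xh + u \<bullet> d) + 0 * C) (at_right 0)"
    by (intro tendsto_intros)
  moreover have "\<forall>\<^sub>F t in at_right 0. 0 \<le> (f x - f xh + u \<bullet> d) + t * C"
    using eventually_at_right_real[OF zero_less_one]
    by eventually_elim (auto intro!: first_order)
  ultimately have "0 \<le> (f x - f xh + u \<bullet> d) + 0 * C"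
    by (intro tendsto_lowerbound) auto
  then show ?thesis
    by (simp add: d_def inner_diff_right inner_commute)
qed

text \<open>Since \<open>xh\<close> minimises the Lagrangian at \<open>u\<close>, the vector \<open>h xh\<close> is a supergradient of the
  dual function at \<open>u\<close>; the rest is the obtuse angle property of the projection
  \<open>u = max0 (y + c h(xh))\<close>.\<close>

lemma augmented_lagrangian_step_is_proximal:
  assumes f: "convex_on X f" and h: "\<And>i. convex_on X (\<lambda>x. h x $ i)" and c: "c > 0"
    and bdd: "bdd_below (f ` X)" "\<And>x. x \<in> X \<Longrightarrow> norm (h x) \<le> H"
    and xh: "is_arg_min (\<lambda>z. aug_lagrangian f h z y c) (\<lambda>z. z \<in> X) xh"
    and p: "p \<in> nonneg_orthant"
  defines "u \<equiv> max0 (y + c *\<^sub>R h xh)"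
  shows "(norm (u - p))\<^sup>2 \<le> (norm (y - p))\<^sup>2 - 2 * c * (real_dual X f h p - real_dual X f h u)"
proof -
  have xhX: "xh \<in> X"
    using xh by (simp add: is_arg_min_def)
  have "real_dual X f h p \<le> f xh + h xh \<bullet> p"
    unfolding real_dual_def using xhX by (intro cINF_lower lagrangian_bdd_below[OF bdd])
  moreover have "f xh + h xh \<bullet> u \<le> real_dual X f h u"
    unfolding real_dual_def u_def using xhX
    by (intro cINF_greatest aug_lagrangian_minimizer_minimizes_lagrangian[OF f h c xh]) auto
  ultimately have "real_dual X f h p - real_dual X f h u \<le> h xh \<bullet> (p - u)"
    by (simp add: inner_diff_right)
  then have "c * (real_dual X f h p - real_dual X f h u) \<le> c * (h xh \<bullet> (p - u))"
    using c by (intro mult_left_mono) auto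
  also have "\<dots> \<le> (u - y) \<bullet> (p - u)"
    using max0_obtuse[OF p, of "y + c *\<^sub>R h xh"]
    by (simp add: u_def[symmetric] inner_diff_left inner_add_left)
  also have "\<dots> = ((norm (y - p))\<^sup>2 - (norm (u - y))\<^sup>2 - (norm (u - p))\<^sup>2) / 2"
    by (simp add: power2_norm_eq_inner inner_diff_left inner_diff_right inner_commute field_simps)
  finally show ?thesis
    using zero_le_power2[of "norm (u - y)"] by argo
qed

section \<open>Convergence of the inexact proximal point method\<close>

lemma convergent_if_decreasing_up_to_summable:
  fixes a e :: "nat \<Rightarrow> real"
  assumes "\<And>k. a (Suc k) \<le> a k + e k" "\<And>k. 0 \<le> a k" "\<And>k. 0 \<le> e k" "summable e"
  shows "convergent a"
proof -
  define s where "s k = a k - (\<Sum>j<k. e j)" for k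
  have "decseq s"
    using assms(1) by (auto simp: decseq_Suc_iff s_def algebra_simps)
  moreover have "- suminf e \<le> s k" for k
    using sum_le_suminf[OF assms(4), of "{..<k}"] assms(2)[of k] assms(3)
    by (simp add: s_def)
  ultimately obtain l where "s \<longlonglongrightarrow> l"
    using decseq_convergent by blast
  then have "(\<lambda>k. s k + (\<Sum>j<k. e j)) \<longlonglongrightarrow> l + suminf e"
    by (intro tendsto_add summable_LIMSEQ assms(4))
  then show ?thesis
    by (auto simp: s_def convergent_def)
qed

text \<open>Here \<open>yh k\<close> is the exact step from \<open>y k\<close>, and \<open>y (Suc k)\<close> is the computed approximation of
  it.  If the distances to \<open>p\<close> had a positive limit \<open>d\<close>, then the exact steps would eventually lie
  in the compact set of points of \<open>S\<close> at distance between \<open>d / 2\<close> and \<open>2 d\<close> from \<open>p\<close>, where \<open>g\<close>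
  stays below \<open>g p\<close> by a fixed amount.\<close>

lemma inexact_proximal_point_converges:
  fixes y yh :: "nat \<Rightarrow> 'a::{real_normed_vector, heine_borel}" and g :: "'a \<Rightarrow> real"
  assumes S: "closed S" and g: "continuous_on S g"
    and p: "\<And>z. z \<in> S \<Longrightarrow> z \<noteq> p \<Longrightarrow> g z < g p"
    and yh: "\<And>k. yh k \<in> S"
    and step: "\<And>k. (norm (yh k - p))\<^sup>2 \<le> (norm (y k - p))\<^sup>2 - 2 * c k * (g p - g (yh k))"
    and c: "\<And>k. 0 \<le> c k" "\<not> summable c"
    and err: "summable (\<lambda>k. norm (y (Suc k) - yh k))"
  shows "y \<longlonglongrightarrow> p"
proof -
  define a where "a k = norm (y k - p)" for k
  define b where "b k = norm (yh k - p)" for k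
  define e where "e k = norm (y (Suc k) - yh k)" for k
  have "0 \<le> g p - g (yh k)" for k
    using p[OF yh, of k] by (cases "yh k = p") auto
  then have gap_nonneg: "0 \<le> 2 * c k * (g p - g (yh k))" for k
    using c(1) by simp
  have "(b k)\<^sup>2 \<le> (a k)\<^sup>2" for k
    using step[of k] gap_nonneg[of k] unfolding a_def b_def by linarith
  then have ba: "b k \<le> a k" for k
    unfolding a_def by (rule power2_le_imp_le) simp
  have ab: "\<bar>a (Suc k) - b k\<bar> \<le> e k" for k
    using norm_triangle_ineq3[of "y (Suc k) - p" "yh k - p"] by (simp add: a_def b_def e_def)
  have "convergent a"
  proof (rule convergent_if_decreasing_up_to_summable)
    show "a (Suc k) \<le> a k + e k" for k
      using ba[of k] ab[of k] by linarith
  qed (use err in \<open>auto simp: a_def e_def\<close>)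
  then obtain d where d: "a \<longlonglongrightarrow> d"
    by (auto simp: convergent_def)
  have "0 \<le> d"
    by (rule LIMSEQ_le_const[OF d]) (auto simp: a_def)
  have e0: "e \<longlonglongrightarrow> 0"
    using summable_LIMSEQ_zero[OF err] by (simp add: e_def[abs_def])
  have bd: "b \<longlonglongrightarrow> d"
  proof (rule tendsto_sandwich[OF _ _ _ d])
    show "(\<lambda>k. a (Suc k) - e k) \<longlonglongrightarrow> d"
      using tendsto_diff[OF LIMSEQ_Suc[OF d] e0] by simp
    show "\<forall>\<^sub>F k in sequentially. a (Suc k) - e k \<le> b k"
    proof (rule always_eventually, rule allI)
      show "a (Suc k) - e k \<le> b k" for k
        using ab[of k] by linarith
    qed
  qed (use ba in auto)
  have "d = 0"
  proof (rule ccontr)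
    assume "d \<noteq> 0"
    with \<open>0 \<le> d\<close> have "0 < d"
      by simp
    define K where "K = S \<inter> (cball p (2 * d) - ball p (d / 2))"
    have K: "z \<in> K \<longleftrightarrow> z \<in> S \<and> d / 2 \<le> norm (z - p) \<and> norm (z - p) \<le> 2 * d" for z
      by (auto simp: K_def dist_norm norm_minus_commute)
    have "compact K"
      unfolding K_def by (intro closed_Int_compact S compact_diff) auto
    have b_bounds: "\<forall>\<^sub>F k in sequentially. d / 2 < b k \<and> b k < 2 * d"
      using \<open>0 < d\<close> by (intro eventually_conj order_tendstoD[OF bd]) auto
    have yhK: "\<forall>\<^sub>F k in sequentially. yh k \<in> K"
      using b_bounds by eventually_elim (use yh in \<open>auto simp: K b_def\<close>)
    then have "K \<noteq> {}"
      by (metis empty_iff eventually_happens sequentially_bot)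
    moreover have "continuous_on K g"
      using g by (rule continuous_on_subset) (auto simp: K_def)
    ultimately obtain z where z: "z \<in> K" "\<And>w. w \<in> K \<Longrightarrow> g w \<le> g z"
      using continuous_attains_sup[OF \<open>compact K\<close>] by blast
    define \<eta> where "\<eta> = g p - g z"
    have "0 < \<eta>"
      using p[of z] z(1) \<open>0 < d\<close> by (cases "z = p") (auto simp: K \<eta>_def)
    \<comment> \<open>The differences of squares telescope, so this bounds \<open>c\<close> by a summable sequence.\<close>
    have "\<forall>\<^sub>F k in sequentially. norm (c k) \<le>
        (((a k)\<^sup>2 - (a (Suc k))\<^sup>2) + 4 * d * e k) * inverse (2 * \<eta>)"
      using b_bounds yhK order_tendstoD(2)[OF LIMSEQ_Suc[OF d], of "2 * d", simplified, OF \<open>0 < d\<close>]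
    proof eventually_elim
      case (elim k)
      have "2 * c k * \<eta> \<le> 2 * c k * (g p - g (yh k))"
        using z(2)[of "yh k"] elim c(1)[of k] by (intro mult_left_mono) (auto simp: \<eta>_def)
      also have "\<dots> \<le> (a k)\<^sup>2 - (b k)\<^sup>2"
        using step[of k] by (simp add: a_def b_def)
      also have "(a (Suc k))\<^sup>2 - (b k)\<^sup>2 \<le> 4 * d * e k"
      proof -
        have "(a (Suc k))\<^sup>2 - (b k)\<^sup>2 = (a (Suc k) + b k) * (a (Suc k) - b k)"
          by (simp add: power2_eq_square algebra_simps)
        also have "\<dots> \<le> (4 * d) * e k"
        proof -
          have "(a (Suc k) + b k) * (a (Suc k) - b k) \<le> (a (Suc k) + b k) * e k"
            using ab[of k] by (intro mult_left_mono) (auto simp: a_def b_def)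
          also have "\<dots> \<le> (4 * d) * e k"
            using elim by (intro mult_right_mono) (auto simp: e_def)
          finally show ?thesis .
        qed
        finally show ?thesis .
      qed
      then have "(a k)\<^sup>2 - (b k)\<^sup>2 \<le> ((a k)\<^sup>2 - (a (Suc k))\<^sup>2) + 4 * d * e k"
        by simp
      finally show ?case
        using \<open>0 < \<eta>\<close> c(1)[of k] by (simp add: field_simps)
    qed
    moreover have "summable (\<lambda>k. (((a k)\<^sup>2 - (a (Suc k))\<^sup>2) + 4 * d * e k) * inverse (2 * \<eta>))"
      using err
      by (intro summable_mult2 summable_add summable_mult telescope_summable'[OF tendsto_power[OF d]])
        (simp add: e_def)
    ultimately have "summable c"
      by (rule summable_comparison_test_ev)
    with c(2) show False ..
  qed
  then show ?thesis
    using d by (simp add: a_def[abs_def] tendsto_norm_zero_iff LIM_zero_iff)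
qed

section \<open>Summability of the noise and of the multiplier errors\<close>

lemma second_moment_le_if_cond_second_moment_le:
  assumes M: "prob_space M" and \<epsilon>_meas: "\<And>k. k \<ge> 1 \<Longrightarrow> \<epsilon> k \<in> borel_measurable M"
    and \<epsilon>: "error_condition M \<epsilon> \<sigma>" and k: "k \<ge> 1"
  shows "(\<integral>\<^sup>+\<omega>. ennreal ((norm (\<epsilon> k \<omega>))\<^sup>2) \<partial>M) \<le> ennreal (\<sigma>\<^sup>2)"
proof -
  interpret prob_space M by fact
  let ?F = "error_sigma_algebra M \<epsilon> (k - 1)"
  have [measurable]: "\<epsilon> k \<in> borel_measurable M"
    by (rule \<epsilon>_meas[OF k])
  have "(\<Union>j\<in>{1..k-1}. {\<epsilon> j -` A \<inter> space M |A. A \<in> sets borel}) \<subseteq> sets M" (is "?A \<subseteq> _")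
    using \<epsilon>_meas by (auto intro: measurable_sets)
  moreover have "?A \<subseteq> Pow (space M)"
    by auto
  ultimately have "subalgebra M ?F"
    by (simp add: subalgebra_def error_sigma_algebra_def sets.sigma_sets_subset)
  then interpret finite_measure_subalgebra M ?F
    by unfold_locales
  have "(\<integral>\<^sup>+\<omega>. ennreal ((norm (\<epsilon> k \<omega>))\<^sup>2) \<partial>M)
      = (\<integral>\<^sup>+\<omega>. nn_cond_exp M ?F (\<lambda>\<omega>. ennreal ((norm (\<epsilon> k \<omega>))\<^sup>2)) \<omega> \<partial>M)"
    using nn_cond_exp_intg[of "\<lambda>_. 1" "\<lambda>\<omega>. ennreal ((norm (\<epsilon> k \<omega>))\<^sup>2)"] by simp
  also have "\<dots> \<le> (\<integral>\<^sup>+\<omega>. ennreal (\<sigma>\<^sup>2) \<partial>M)"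
    using \<epsilon> k by (intro nn_integral_mono_AE) (auto simp: error_condition_def)
  finally show ?thesis
    by (simp add: emeasure_space_1)
qed

text \<open>By monotone convergence the sum has an expectation of at most \<open>\<sigma>\<^sup>2 \<Sum> w\<close>, so it is almost
  surely finite.\<close>

lemma weighted_squared_errors_summable:
  assumes M: "prob_space M" and \<epsilon>_meas: "\<And>k. k \<ge> 1 \<Longrightarrow> \<epsilon> k \<in> borel_measurable M"
    and \<epsilon>: "error_condition M \<epsilon> \<sigma>" and w: "\<And>k. 0 \<le> w k" "summable w"
  shows "AE \<omega> in M. summable (\<lambda>k. w k * (norm (\<epsilon> (Suc k) \<omega>))\<^sup>2)"
proof -
  have [measurable]: "\<epsilon> (Suc k) \<in> borel_measurable M" for k
    by (rule \<epsilon>_meas) simp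
  have "(\<integral>\<^sup>+\<omega>. (\<Sum>k. ennreal (w k * (norm (\<epsilon> (Suc k) \<omega>))\<^sup>2)) \<partial>M)
      = (\<Sum>k. \<integral>\<^sup>+\<omega>. ennreal (w k * (norm (\<epsilon> (Suc k) \<omega>))\<^sup>2) \<partial>M)"
    by (intro nn_integral_suminf) measurable
  also have "\<dots> \<le> (\<Sum>k. ennreal (w k * \<sigma>\<^sup>2))"
  proof (intro suminf_le summableI)
    fix k
    have "(\<integral>\<^sup>+\<omega>. ennreal (w k * (norm (\<epsilon> (Suc k) \<omega>))\<^sup>2) \<partial>M)
        = ennreal (w k) * (\<integral>\<^sup>+\<omega>. ennreal ((norm (\<epsilon> (Suc k) \<omega>))\<^sup>2) \<partial>M)"
      using w(1) by (simp add: ennreal_mult' nn_integral_cmult)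
    also have "\<dots> \<le> ennreal (w k) * ennreal (\<sigma>\<^sup>2)"
      by (intro mult_left_mono second_moment_le_if_cond_second_moment_le[OF M \<epsilon>_meas \<epsilon>]) auto
    finally show "(\<integral>\<^sup>+\<omega>. ennreal (w k * (norm (\<epsilon> (Suc k) \<omega>))\<^sup>2) \<partial>M) \<le> ennreal (w k * \<sigma>\<^sup>2)"
      using w(1) by (simp add: ennreal_mult')
  qed
  finally have "(\<integral>\<^sup>+\<omega>. (\<Sum>k. ennreal (w k * (norm (\<epsilon> (Suc k) \<omega>))\<^sup>2)) \<partial>M) \<noteq> \<top>"
    using ennreal_suminf_neq_top[OF summable_mult2[OF w(2), of "\<sigma>\<^sup>2"]] w(1)
    by (metis mult_nonneg_nonneg neq_top_trans zero_le_power2)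
  then have "AE \<omega> in M. (\<Sum>k. ennreal (w k * (norm (\<epsilon> (Suc k) \<omega>))\<^sup>2)) \<noteq> \<infinity>"
    unfolding infinity_ennreal_def[symmetric] by (intro nn_integral_PInf_AE) measurable
  then show ?thesis
  proof eventually_elim
    case (elim \<omega>)
    then show ?case
      using w(1) by (intro summable_suminf_not_top) auto
  qed
qed

text \<open>The points \<open>xh k - c k \<epsilon>\<close> may leave \<open>X\<close>, so a Lipschitz bound for \<open>h\<close> beyond \<open>X\<close> is
  required; it comes from the bounded gradients of a \<open>C\<^sup>1\<close> map on a ball.\<close>

lemma cont_differentiable_lipschitz_on_cball:
  fixes f :: "real^'n \<Rightarrow> real"
  assumes "cont_differentiable f"
  obtains B where "0 \<le> B" "\<And>x z. x \<in> cball 0 R \<Longrightarrow> z \<in> cball 0 R \<Longrightarrow> \<bar>f x - f z\<bar> \<le> B * norm (x - z)"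
proof -
  obtain G where G: "\<And>x. GDERIV f x :> G x" and contG: "continuous_on UNIV G"
    using assms by (auto simp: cont_differentiable_def)
  have "compact (G ` cball 0 R)"
    by (intro compact_continuous_image continuous_on_subset[OF contG]) auto
  then obtain B where B: "0 < B" "\<And>x. x \<in> cball 0 R \<Longrightarrow> norm (G x) \<le> B"
    by (metis bounded_pos compact_imp_bounded imageI)
  have "norm (f x - f z) \<le> B * norm (x - z)" if "x \<in> cball 0 R" "z \<in> cball 0 R" for x z
  proof (rule differentiable_bound[where S = "cball 0 R" and f' = "\<lambda>x v. v \<bullet> G x"])
    show "(f has_derivative (\<lambda>v. v \<bullet> G x)) (at x within cball 0 R)" for x
      using G[of x] by (auto simp: gderiv_def intro: has_derivative_at_withinI)
    show "onorm (\<lambda>v. v \<bullet> G x) \<le> B" if "x \<in> cball 0 R" for x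
    proof (rule onorm_bound)
      show "norm (v \<bullet> G x) \<le> B * norm v" for v
        using Cauchy_Schwarz_ineq2[of v "G x"] mult_right_mono[OF B(2)[OF that], of "norm v"]
        by (simp add: mult.commute)
    qed (use B(1) in simp)
  qed (use that in auto)
  then show ?thesis
    using that[of B] B(1) by simp
qed

lemma cont_differentiable_components_lipschitz_on_cball:
  fixes h :: "real^'n \<Rightarrow> real^'m"
  assumes "\<And>i. cont_differentiable (\<lambda>x. h x $ i)"
  obtains B where "0 \<le> B"
    "\<And>x z. x \<in> cball 0 R \<Longrightarrow> z \<in> cball 0 R \<Longrightarrow> norm (h x - h z) \<le> B * norm (x - z)"
proof -
  have "\<exists>B. 0 \<le> B \<and> (\<forall>x\<in>cball 0 R. \<forall>z\<in>cball 0 R. \<bar>h x $ i - h z $ i\<bar> \<le> B * norm (x - z))" for i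
    using cont_differentiable_lipschitz_on_cball[OF assms[of i], of R] by metis
  then obtain B where B: "\<And>i. 0 \<le> B i"
      "\<And>i x z. x \<in> cball 0 R \<Longrightarrow> z \<in> cball 0 R \<Longrightarrow> \<bar>h x $ i - h z $ i\<bar> \<le> B i * norm (x - z)"
    by metis
  have "norm (h x - h z) \<le> (\<Sum>i\<in>UNIV. B i) * norm (x - z)"
    if "x \<in> cball 0 R" "z \<in> cball 0 R" for x z
  proof -
    have "norm (h x - h z) \<le> (\<Sum>i\<in>UNIV. \<bar>(h x - h z) $ i\<bar>)"
      by (rule norm_le_l1_cart)
    also have "\<dots> \<le> (\<Sum>i\<in>UNIV. B i * norm (x - z))"
      using B(2)[OF that] by (intro sum_mono) simp
    finally show ?thesis
      by (simp add: sum_distrib_right)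
  qed
  moreover have "0 \<le> (\<Sum>i\<in>UNIV. B i)"
    using B(1) by (intro sum_nonneg) auto
  ultimately show ?thesis
    using that by blast
qed

text \<open>The multiplier steps taken at \<open>xh k\<close> and at \<open>xh k - c k \<epsilon>\<close> differ by at most
  \<open>B (c k)\<^sup>2 \<parallel>\<epsilon>\<parallel>\<close> once the second point is close to \<open>X\<close>, which holds eventually because
  \<open>(c k)\<^sup>2 \<parallel>\<epsilon>\<parallel>\<^sup>2\<close> is summable.  The bound is summable since \<open>\<parallel>\<epsilon>\<parallel> \<le> 1 + \<parallel>\<epsilon>\<parallel>\<^sup>2\<close>.\<close>

lemma multiplier_errors_summable:
  fixes h :: "real^'n \<Rightarrow> real^'m" and e xh :: "nat \<Rightarrow> real^'n" and y :: "nat \<Rightarrow> real^'m"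
  assumes h: "\<And>i. cont_differentiable (\<lambda>x. h x $ i)"
    and X: "bounded X" "\<And>k. xh k \<in> X"
    and c: "\<And>k. 0 \<le> c k" "summable (\<lambda>k. (c k)\<^sup>2)" "summable (\<lambda>k. (c k)\<^sup>2 * (norm (e k))\<^sup>2)"
  shows "summable (\<lambda>k. norm (max0 (y k + c k *\<^sub>R h (xh k - c k *\<^sub>R e k))
                             - max0 (y k + c k *\<^sub>R h (xh k))))"
proof -
  obtain R where R: "\<And>x. x \<in> X \<Longrightarrow> norm x \<le> R"
    using X(1) by (auto simp: bounded_iff)
  obtain B where B: "0 \<le> B" "\<And>x z. x \<in> cball 0 (R + 1) \<Longrightarrow> z \<in> cball 0 (R + 1) \<Longrightarrow>
      norm (h x - h z) \<le> B * norm (x - z)"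
    using cont_differentiable_components_lipschitz_on_cball[OF h] by blast
  have "\<forall>\<^sub>F k in sequentially. (c k)\<^sup>2 * (norm (e k))\<^sup>2 < 1"
    using order_tendstoD(2)[OF summable_LIMSEQ_zero[OF c(3)]] by simp
  then have "\<forall>\<^sub>F k in sequentially. norm (norm (max0 (y k + c k *\<^sub>R h (xh k - c k *\<^sub>R e k))
      - max0 (y k + c k *\<^sub>R h (xh k)))) \<le> B * ((c k)\<^sup>2 + (c k)\<^sup>2 * (norm (e k))\<^sup>2)"
  proof eventually_elim
    case (elim k)
    have "(c k * norm (e k))\<^sup>2 < 1\<^sup>2"
      using elim by (simp add: power_mult_distrib)
    then have "c k * norm (e k) < 1"
      by (rule power2_less_imp_less) simp
    then have mem: "xh k - c k *\<^sub>R e k \<in> cball 0 (R + 1)" "xh k \<in> cball 0 (R + 1)"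
      using R[OF X(2)[of k]] norm_triangle_ineq4[of "xh k" "c k *\<^sub>R e k"] c(1)[of k] by auto
    have "norm (max0 (y k + c k *\<^sub>R h (xh k - c k *\<^sub>R e k)) - max0 (y k + c k *\<^sub>R h (xh k)))
        \<le> norm (c k *\<^sub>R (h (xh k - c k *\<^sub>R e k) - h (xh k)))"
      using max0_nonexpansive[of "y k + c k *\<^sub>R h (xh k - c k *\<^sub>R e k)" "y k + c k *\<^sub>R h (xh k)"]
      by (simp add: scaleR_diff_right)
    also have "\<dots> \<le> c k * (B * (c k * norm (e k)))"
      using B(2)[OF mem] c(1)[of k] by (auto intro!: mult_left_mono)
    also have "\<dots> = B * ((c k)\<^sup>2 * norm (e k))"
      by (simp add: power2_eq_square)
    also have "\<dots> \<le> B * ((c k)\<^sup>2 * (1 + (norm (e k))\<^sup>2))"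
    proof -
      have "norm (e k) \<le> 1 + (norm (e k))\<^sup>2"
        using zero_le_power2[of "norm (e k) - 1"] norm_ge_zero[of "e k"]
        unfolding power2_diff by (simp del: norm_ge_zero)
      then show ?thesis
        using B(1) by (intro mult_left_mono) auto
    qed
    finally show ?case
      by (simp add: algebra_simps)
  qed
  then show ?thesis
    by (rule summable_comparison_test_ev) (intro summable_mult summable_add c)
qed

section \<open>Almost sure convergence of the multipliers\<close>

lemma power_step_sizes:
  fixes c :: "nat \<Rightarrow> real"
  assumes "q \<in> {1/2<..1}" "c 0 > 0" "\<And>k. k \<ge> 1 \<Longrightarrow> c k = c 0 * real k powr (- q)"
  shows "c k > 0" "summable (\<lambda>k. (c k)\<^sup>2)" "\<not> summable c"
proof -
  show "c k > 0"
    using assms(2,3) by (cases "k = 0") auto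
  have ev: "\<forall>\<^sub>F k in sequentially. c k = c 0 * real k powr (- q)"
    using eventually_ge_at_top[of 1] by eventually_elim (rule assms(3))
  have "summable (\<lambda>k. (c 0)\<^sup>2 * real k powr (- (2 * q)))"
    using assms(1) summable_real_powr_iff[of "- (2 * q)"] by (intro summable_mult) simp
  also have "?this \<longleftrightarrow> summable (\<lambda>k. (c k)\<^sup>2)"
    by (intro summable_cong eventually_mono[OF ev])
      (simp add: power_mult_distrib power2_eq_square flip: powr_add)
  finally show "summable (\<lambda>k. (c k)\<^sup>2)" .
  have "summable c \<longleftrightarrow> summable (\<lambda>k. c 0 * real k powr (- q))"
    by (intro summable_cong ev)
  also have "\<dots> \<longleftrightarrow> summable (\<lambda>k. real k powr (- q))"
    using assms(2) by (simp add: summable_cmult_iff)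
  also have "\<not> \<dots>"
    using assms(1) summable_real_powr_iff[of "- q"] by simp
  finally show "\<not> summable c" .
qed

lemma strictly_convex_on_imp_convex_on:
  assumes "strictly_convex_on X f"
  shows "convex_on X f"
proof (rule convex_onI)
  fix t :: real and x y assume t: "0 < t" "t < 1" and xy: "x \<in> X" "y \<in> X"
  show "f ((1 - t) *\<^sub>R x + t *\<^sub>R y) \<le> (1 - t) * f x + t * f y"
  proof (cases "x = y")
    case True
    then show ?thesis
      by (simp add: algebra_simps flip: scaleR_add_left)
  next
    case False
    then show ?thesis
      using assms t xy by (force simp: strictly_convex_on_def intro: less_imp_le)
  qed
qed (use assms in \<open>simp add: strictly_convex_on_def\<close>)

text \<open>Boundedness from below is read off from the existence of a minimiser of the augmented
  Lagrangian, whose other terms are bounded; this avoids a continuity argument for the integral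
  that defines the objective.\<close>

lemma bdd_below_if_aug_lagrangian_minimizer:
  fixes h :: "real^'n \<Rightarrow> real^'m"
  assumes xh: "is_arg_min (\<lambda>z. aug_lagrangian f h z y c) (\<lambda>z. z \<in> X) xh" and c: "c > 0"
    and H: "\<And>x. x \<in> X \<Longrightarrow> norm (h x) \<le> H"
  shows "bdd_below (f ` X)"
proof -
  let ?C = "c / 2 * (H + norm (y /\<^sub>R c))\<^sup>2"
  have "aug_lagrangian f h xh y c - ?C \<le> f x" if "x \<in> X" for x
  proof -
    have "norm (max0 (h x + y /\<^sub>R c)) \<le> norm (h x + y /\<^sub>R c)"
    proof -
      have "max0 (0 :: real^'m) = 0"
        by (simp add: max0_def vec_eq_iff)
      then show ?thesis
        using max0_nonexpansive[of "h x + y /\<^sub>R c" 0] by simp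
    qed
    also have "\<dots> \<le> H + norm (y /\<^sub>R c)"
      using H[OF that] norm_triangle_ineq[of "h x" "y /\<^sub>R c"] by linarith
    finally have "c / 2 * (norm (max0 (h x + y /\<^sub>R c)))\<^sup>2 \<le> ?C"
      using c by (intro mult_left_mono power_mono) auto
    moreover have "aug_lagrangian f h xh y c \<le> aug_lagrangian f h x y c"
      using xh that by (auto simp: is_arg_min_def not_less)
    moreover have "0 \<le> 1 / (2 * c) * (norm y)\<^sup>2"
      using c by simp
    ultimately show ?thesis
      unfolding aug_lagrangian_def[of f h x] pos_proj_eq_max0 by linarith
  qed
  then show ?thesis
    by (auto simp: bdd_below_def)
qed

lemma unique_dual_solution_real_dual:
  fixes h :: "real^'n \<Rightarrow> real^'m"
  assumes X: "X \<noteq> {}" and bdd: "\<And>y. bdd_below ((\<lambda>x. f x + h x \<bullet> y) ` X)"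
    and p: "dual_solutions X f h = {p}"
  shows "p \<in> nonneg_orthant"
    "\<And>z. z \<in> nonneg_orthant \<Longrightarrow> z \<noteq> p \<Longrightarrow> real_dual X f h z < real_dual X f h p"
proof -
  have max: "dual_fun X f h z \<le> dual_fun X f h p" for z
    using p by (auto simp: dual_solutions_def is_arg_max_def not_less)
  note eq = dual_fun_eq_real_dual[OF X bdd]
  obtain z0 :: "real^'m" where z0: "z0 \<in> nonneg_orthant"
    using nonneg_orthant_convex_closed(3) by blast
  show p0: "p \<in> nonneg_orthant"
  proof (rule ccontr)
    assume "p \<notin> nonneg_orthant"
    then have "dual_fun X f h p = -\<infinity>"
      by (simp add: dual_fun_def)
    then show False
      using max[of z0] eq[OF z0] by simp
  qed
  fix z assume z: "z \<in> nonneg_orthant" "z \<noteq> p"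
  then have "z \<notin> dual_solutions X f h"
    using p by simp
  then obtain w where w: "dual_fun X f h z < dual_fun X f h w"
    by (auto simp: dual_solutions_def is_arg_max_def)
  show "real_dual X f h z < real_dual X f h p"
    using less_le_trans[OF w max[of w]] eq[OF z(1)] eq[OF p0] by simp
qed

theorem theorem2p3:
  fixes X :: "(real^'n) set"
    and f0 :: "real^'n \<Rightarrow> real"
    and h :: "real^'n \<Rightarrow> real^'m"
    and P :: "'s measure"
    and F :: "real^'n \<Rightarrow> 's \<Rightarrow> real"
    and f :: "real^'n \<Rightarrow> real"
    and M :: "'w measure"
    and \<epsilon> :: "nat \<Rightarrow> 'w \<Rightarrow> real^'n"
    and x0 :: "real^'n" and y0 :: "real^'m"
    and xh x :: "nat \<Rightarrow> 'w \<Rightarrow> real^'n"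
    and y :: "nat \<Rightarrow> 'w \<Rightarrow> real^'m"
    and c :: "nat \<Rightarrow> real" and q L\<^sub>h \<sigma> :: real
    and ystar :: "real^'m"
  assumes X: "X \<noteq> {}" "convex X" "compact X"
    and f0: "cont_differentiable f0" "convex_on UNIV f0"
    and h: "\<And>i. cont_differentiable (\<lambda>x. h x $ i)" "\<And>i. convex_on UNIV (\<lambda>x. h x $ i)"
    and P: "prob_space P"
    and F: "AE \<xi> in P. cont_differentiable (\<lambda>x. F x \<xi>) \<and> convex_on UNIV (\<lambda>x. F x \<xi>)"
    and F_integrable: "\<And>x. x \<in> X \<Longrightarrow> integrable P (F x)"
    and f_def: "f = objective f0 P F"
    and f_strictly_convex: "strictly_convex_on X f"
    and h_lipschitz: "L\<^sub>h > 0" "\<And>x y. x \<in> X \<Longrightarrow> y \<in> X \<Longrightarrow> norm (h x - h y) \<le> L\<^sub>h * norm (x - y)"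
    and M: "prob_space M"
    and \<epsilon>_measurable: "\<And>k. k \<ge> 1 \<Longrightarrow> \<epsilon> k \<in> borel_measurable M"
    and \<epsilon>: "\<sigma> > 0" "error_condition M \<epsilon> \<sigma>"
    and q: "q \<in> {1/2<..1}"
    and c: "c 0 > 0" "\<And>k. k \<ge> 1 \<Longrightarrow> c k = c 0 * real k powr (- q)"
    and y0: "y0 \<in> nonneg_orthant"
    and SALM: "\<And>\<omega>. \<omega> \<in> space M \<Longrightarrow>
      SALM X f h x0 y0 c (\<lambda>k. \<epsilon> k \<omega>) (\<lambda>k. xh k \<omega>) (\<lambda>k. x k \<omega>) (\<lambda>k. y k \<omega>)"
    and dual_unique: "dual_solutions X f h = {ystar}"
  shows "AE \<omega> in M. (\<lambda>k. y k \<omega>) \<longlonglongrightarrow> ystar"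
proof -
  interpret prob_space M by (rule M)
  note c_pos = power_step_sizes(1)[OF q c] and c_sq = power_step_sizes(2)[OF q c]
    and c_div = power_step_sizes(3)[OF q c]
  have f_convex: "convex_on X f"
    by (rule strictly_convex_on_imp_convex_on[OF f_strictly_convex])
  have h_convex: "convex_on X (\<lambda>x. h x $ i)" for i
    using h(2) by (rule convex_on_subset) (use X(2) in auto)
  obtain H where H: "\<And>x. x \<in> X \<Longrightarrow> norm (h x) \<le> H"
  proof -
    obtain a where "a \<in> X"
      using X(1) by blast
    obtain R where R: "\<And>x. x \<in> X \<Longrightarrow> norm x \<le> R"
      using compact_imp_bounded[OF X(3)] by (auto simp: bounded_iff)
    have "norm (h x) \<le> norm (h a) + L\<^sub>h * (R + norm a)" if "x \<in> X" for x
    proof -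
      have "norm (h x) \<le> norm (h a) + L\<^sub>h * norm (x - a)"
        using h_lipschitz(2)[OF that \<open>a \<in> X\<close>] norm_triangle_sub[of "h x" "h a"] by linarith
      moreover have "L\<^sub>h * norm (x - a) \<le> L\<^sub>h * (R + norm a)"
        using R[OF that] norm_triangle_ineq4[of x a] h_lipschitz(1) by (intro mult_left_mono) auto
      ultimately show ?thesis
        by linarith
    qed
    then show ?thesis
      by (rule that)
  qed
  have f_bdd: "bdd_below (f ` X)"
  proof -
    obtain \<omega> where "\<omega> \<in> space M"
      using not_empty by blast
    then have "is_arg_min (\<lambda>z. aug_lagrangian f h z (y 0 \<omega>) (c 0)) (\<lambda>z. z \<in> X) (xh (Suc 0) \<omega>)"
      using SALM[of \<omega>] unfolding SALM_def by blast
    then show ?thesis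
      using c_pos H by (rule bdd_below_if_aug_lagrangian_minimizer)
  qed
  note dual = unique_dual_solution_real_dual[OF X(1) lagrangian_bdd_below[OF f_bdd H] dual_unique]
  have "AE \<omega> in M. summable (\<lambda>k. (c k)\<^sup>2 * (norm (\<epsilon> (Suc k) \<omega>))\<^sup>2)"
    by (rule weighted_squared_errors_summable[OF M \<epsilon>_measurable \<epsilon>(2) _ c_sq]) auto
  then show ?thesis
    using AE_space
  proof eventually_elim
    case (elim \<omega>)
    have arg_min: "is_arg_min (\<lambda>z. aug_lagrangian f h z (y k \<omega>) (c k)) (\<lambda>z. z \<in> X) (xh (Suc k) \<omega>)"
      and y_Suc: "y (Suc k) \<omega> =
        max0 (y k \<omega> + c k *\<^sub>R h (xh (Suc k) \<omega> - c k *\<^sub>R \<epsilon> (Suc k) \<omega>))" for k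
      using SALM[OF elim(2)] unfolding SALM_def by auto
    \<comment> \<open>the multiplier that an error-free evaluation of \<open>h\<close> at the minimiser would give\<close>
    define u where "u k = max0 (y k \<omega> + c k *\<^sub>R h (xh (Suc k) \<omega>))" for k
    show "(\<lambda>k. y k \<omega>) \<longlonglongrightarrow> ystar"
    proof (rule inexact_proximal_point_converges[OF nonneg_orthant_convex_closed(2)
          real_dual_continuous[OF X(1) f_bdd H] dual(2)])
      show "u k \<in> nonneg_orthant" for k
        by (simp add: u_def max0_mem_nonneg_orthant)
      show "(norm (u k - ystar))\<^sup>2 \<le> (norm (y k \<omega> - ystar))\<^sup>2
          - 2 * c k * (real_dual X f h ystar - real_dual X f h (u k))" for k
        unfolding u_def by (rule augmented_lagrangian_step_is_proximal[OF f_convex h_convex c_pos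
              f_bdd H arg_min dual(1)])
      show "summable (\<lambda>k. norm (y (Suc k) \<omega> - u k))"
        unfolding y_Suc u_def
        by (rule multiplier_errors_summable[OF h(1) compact_imp_bounded[OF X(3)]])
          (use arg_min c_pos c_sq elim(1) in \<open>auto simp: is_arg_min_def less_imp_le\<close>)
    qed (use c_pos c_div in \<open>auto simp: less_imp_le\<close>)
  qed
qed

end
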